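(* Let $\mathcal{X}=\overline{([-x_1,x_2],0)}$ with $x_1,x_2>0$ and $x_1>x_2$. For any $\mathcal{Y}=\overline{([-y_1,y_2],0)}$ with $y_1,y_2>0$, $\dfrac{x_1}{x_2}>\dfrac{y_2}{y_1}$, $\dfrac{x_1}{x_2}>\dfrac{y_1}{y_2}$, there is $\mathcal{Z}=\overline{([-z_1,z_2],0)}$ (with $[-z_1,z_2]$ an interval) such that $\mathcal{Y}=\mathcal{X}\bullet\mathcal{Z}$.
   Context: $\mathbb{IR}$ is the set of closed bounded intervals $[a,b]$ of $\mathbb{R}$, $a\le b$, with $0=[0,0]$ and addition $[a,b]+[c,d]=[a+c,b+d]$. $\overline{\mathbb{IR}}$ is the quotient of $\mathbb{IR}\times\mathbb{IR}$ by $(x,y)\sim(z,t)\iff x+t=y+z$, with classes $\overline{(x,y)}$. $\mathcal{A}_4$ is the 4-dimensional real algebra with product $x\cdot y=(x_1y_1+x_4y_4,\;x_2y_2+x_3y_3,\;x_3y_2+x_2y_3,\;x_4y_1+x_1y_4)$. The injective map $\varphi:\mathbb{IR}\to\mathcal{A}_4$ sends $[a,b]$ to $(a,b,0,0)$ if $a,b\ge0$, to $(0,b,-a,0)$ if $a\le0\le b$, and to $(0,0,-a,-b)$ if $a,b\le0$. For $K,L\in\mathbb{IR}$ the element $\varphi(K)\cdot\varphi(L)$ lies in the image of $\varphi$ and $\overline{(K,0)}\bullet\overline{(L,0)}=\overline{(\varphi^{-1}(\varphi(K)\cdot\varphi(L)),0)}$. *)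

theory Defs
  imports "HOL-Library.Interval"
begin

definition ivl_pair_rel :: "real interval \<times> real interval \<Rightarrow> real interval \<times> real interval \<Rightarrow> bool"
  where "ivl_pair_rel = (\<lambda>(x, y) (z, t). x + t = y + z)"

lemma ivl_pair_rel_equivp: "equivp ivl_pair_rel"
proof (rule equivpI)
  show "reflp ivl_pair_rel"
    by (auto simp: reflp_def ivl_pair_rel_def add.commute)
  show "symp ivl_pair_rel"
    by (auto simp: symp_def ivl_pair_rel_def add.commute)
  show "transp ivl_pair_rel"
    by (auto simp: transp_def ivl_pair_rel_def interval_eq_iff)
qed

quotient_type gen_interval = "real interval \<times> real interval" / ivl_pair_rel
  by (rule ivl_pair_rel_equivp)

definition gi_class :: "real interval \<Rightarrow> real interval \<Rightarrow> gen_interval"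
  where "gi_class x y = abs_gen_interval (x, y)"

lemma gi_class_eq_iff: "gi_class x y = gi_class z t \<longleftrightarrow> x + t = y + z"
  using gen_interval.abs_eq_iff[of "(x, y)" "(z, t)"]
  by (simp add: gi_class_def ivl_pair_rel_def)

type_synonym a4 = "real \<times> real \<times> real \<times> real"

fun a4_mult :: "a4 \<Rightarrow> a4 \<Rightarrow> a4"  (infixl \<open>\<cdot>\<^sub>4\<close> 70)
  where "(x1, x2, x3, x4) \<cdot>\<^sub>4 (y1, y2, y3, y4) =
    (x1 * y1 + x4 * y4, x2 * y2 + x3 * y3, x3 * y2 + x2 * y3, x4 * y1 + x1 * y4)"

text \<open>The three sign cases overlap when an endpoint is 0; the values agree there
  (see \<open>ivl_phi_cases\<close>).\<close>

definition ivl_phi :: "real interval \<Rightarrow> a4"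
  where "ivl_phi K =
    (let a = lower K; b = upper K in
      if 0 \<le> a \<and> 0 \<le> b then (a, b, 0, 0)
      else if a \<le> 0 \<and> 0 \<le> b then (0, b, - a, 0)
      else (0, 0, - a, - b))"

lemma lower_Interval: "a \<le> b \<Longrightarrow> lower (Interval (a, b)) = a"
  and upper_Interval: "a \<le> b \<Longrightarrow> upper (Interval (a, b)) = b"
  for a b :: real
  by (simp_all add: lower.rep_eq upper.rep_eq Interval_inverse)

lemma ivl_phi_cases:
  fixes a b :: real
  assumes "a \<le> b"
  shows "0 \<le> a \<Longrightarrow> 0 \<le> b \<Longrightarrow> ivl_phi (Interval (a, b)) = (a, b, 0, 0)"
    and "a \<le> 0 \<Longrightarrow> 0 \<le> b \<Longrightarrow> ivl_phi (Interval (a, b)) = (0, b, - a, 0)"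
    and "a \<le> 0 \<Longrightarrow> b \<le> 0 \<Longrightarrow> ivl_phi (Interval (a, b)) = (0, 0, - a, - b)"
  using assms by (auto simp: ivl_phi_def lower_Interval upper_Interval)

lemma inj_ivl_phi: "inj ivl_phi"
proof (rule injI)
  fix K L assume "ivl_phi K = ivl_phi L"
  then show "K = L"
    using lower_le_upper[of K] lower_le_upper[of L]
    by (auto simp: ivl_phi_def Let_def interval_eq_iff split: if_splits)
qed

lemma range_ivl_phi:
  "range ivl_phi = {(a, b, 0, 0) |a b. 0 \<le> a \<and> a \<le> b} \<union> {(0, b, a, 0) |a b. 0 \<le> a \<and> 0 \<le> b}
    \<union> {(0, 0, a, b) |a b. 0 \<le> b \<and> b \<le> a}" (is "_ = ?R")
proof
  show "range ivl_phi \<subseteq> ?R"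
  proof
    fix v assume "v \<in> range ivl_phi"
    then obtain K where "v = ivl_phi K" by blast
    then show "v \<in> ?R"
      using lower_le_upper[of K] by (auto simp: ivl_phi_def Let_def)
  qed
  show "?R \<subseteq> range ivl_phi"
  proof
    fix v assume "v \<in> ?R"
    then consider a b where "v = (a, b, 0, 0)" "0 \<le> a" "a \<le> b"
      | a b where "v = (0, b, a, 0)" "0 \<le> a" "0 \<le> b"
      | a b where "v = (0, 0, a, b)" "0 \<le> b" "b \<le> a" by auto
    then show "v \<in> range ivl_phi"
    proof cases
      case 1 then show ?thesis
        using ivl_phi_cases(1)[of a b] by (metis order_trans rangeI)
    next
      case 2 then show ?thesis
        using ivl_phi_cases(2)[of "- a" b] by (intro range_eqI[of _ _ "Interval (- a, b)"]) simp
    next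
      case 3 then show ?thesis
        using ivl_phi_cases(3)[of "- a" "- b"]
        by (intro range_eqI[of _ _ "Interval (- a, - b)"]) simp
    qed
  qed
qed

lemma ivl_phi_mult_in_range: "ivl_phi K \<cdot>\<^sub>4 ivl_phi L \<in> range ivl_phi"
proof -
  have "ivl_phi K \<in> range ivl_phi" "ivl_phi L \<in> range ivl_phi" by simp_all
  then show ?thesis
    unfolding range_ivl_phi by (auto intro!: mult_mono)
qed

definition gi_embed :: "real interval \<Rightarrow> gen_interval"
  where "gi_embed K = gi_class K 0"

lemma inj_gi_embed: "inj gi_embed"
  by (rule injI) (simp add: gi_embed_def gi_class_eq_iff)

text \<open>Only products of classes of the form \<open>gi_class K 0\<close> matter here; on other arguments
  \<open>inv gi_embed\<close>, and hence the product below, is unspecified. The intended meaning is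
  the equation \<open>gi_mult_class\<close>.\<close>

definition gi_mult :: "gen_interval \<Rightarrow> gen_interval \<Rightarrow> gen_interval"  (infixl \<open>\<bullet>\<^sub>I\<close> 70)
  where "X \<bullet>\<^sub>I Y = gi_class (inv ivl_phi (ivl_phi (inv gi_embed X) \<cdot>\<^sub>4 ivl_phi (inv gi_embed Y))) 0"

lemma gi_mult_class:
  "gi_class K 0 \<bullet>\<^sub>I gi_class L 0 = gi_class (inv ivl_phi (ivl_phi K \<cdot>\<^sub>4 ivl_phi L)) 0"
proof -
  have "inv gi_embed (gi_class M 0) = M" for M
    using inv_f_f[OF inj_gi_embed, of M] by (simp add: gi_embed_def)
  then show ?thesis by (simp add: gi_mult_def)
qed

end

theory Submission
  imports Defs
begin

text \<open>Intervals \<open>[-a, b]\<close> with \<open>a, b \<ge> 0\<close> are sent by \<open>ivl_phi\<close> to the plane of vectors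
  \<open>(0, b, a, 0)\<close>, which is closed under the product of the algebra. On this plane,
  multiplication by \<open>[-x1, x2]\<close> is the symmetric linear map with diagonal entries \<open>x2\<close> and
  off-diagonal entries \<open>x1\<close>, so dividing by \<open>[-x1, x2]\<close> means solving a linear system of two
  equations. Its determinant \<open>x2\<^sup>2 - x1\<^sup>2\<close> is nonzero because \<open>x1 > x2 > 0\<close>, and Cramer's
  rule gives \<open>z1 = (x1 * y2 - x2 * y1) / (x1\<^sup>2 - x2\<^sup>2)\<close> and
  \<open>z2 = (x1 * y1 - x2 * y2) / (x1\<^sup>2 - x2\<^sup>2)\<close>. The two bounds on the ratio \<open>x1 / x2\<close> say
  exactly that both numerators are positive. Hence \<open>[-z1, z2]\<close> again straddles zero, and the
  linear system describes its actual product with \<open>[-x1, x2]\<close>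
  (lemma \<open>gi_mult_straddling_zero\<close>).\<close>

text \<open>Both factors use the middle case of \<open>ivl_phi\<close>, and so does the product: its upper
  endpoint comes from the like-signed endpoints and its lower one from the opposite-signed
  endpoints. Since every term is nonnegative, these sums are of the right sign for
  \<open>ivl_phi\<close> to be inverted.\<close>

lemma gi_mult_straddling_zero:
  fixes a b c d :: real
  assumes "0 \<le> a" "0 \<le> b" "0 \<le> c" "0 \<le> d"
  shows "gi_class (Interval (- a, b)) 0 \<bullet>\<^sub>I gi_class (Interval (- c, d)) 0 =
    gi_class (Interval (- (a * d + b * c), a * c + b * d)) 0"
proof -
  have phi: "ivl_phi (Interval (- p, q)) = (0, q, p, 0)" if "0 \<le> p" "0 \<le> q" for p q :: real
    using ivl_phi_cases(2)[of "- p" q] that by simp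
  have "ivl_phi (Interval (- a, b)) \<cdot>\<^sub>4 ivl_phi (Interval (- c, d)) =
      ivl_phi (Interval (- (a * d + b * c), a * c + b * d))"
    using assms by (simp only: phi add_nonneg_nonneg mult_nonneg_nonneg) simp
  then show ?thesis
    by (simp only: gi_mult_class inv_f_f[OF inj_ivl_phi])
qed

theorem proposition23:
  fixes x1 x2 :: real and X :: gen_interval
  assumes "x1 > 0" and "x2 > 0" and "x1 > x2"
    and "X = gi_class (Interval (- x1, x2)) 0"
  shows "\<forall>(y1 :: real) (y2 :: real) Y.
    y1 > 0 \<and> y2 > 0 \<and> x1 / x2 > y2 / y1 \<and> x1 / x2 > y1 / y2 \<and>
    Y = gi_class (Interval (- y1, y2)) 0 \<longrightarrow>
    (\<exists>(z1 :: real) (z2 :: real) Z.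
      - z1 \<le> z2 \<and> Z = gi_class (Interval (- z1, z2)) 0 \<and> Y = X \<bullet>\<^sub>I Z)"
proof (intro allI impI, elim conjE)
  fix y1 y2 :: real and Y
  assume y: "y1 > 0" "y2 > 0" and ratios: "x1 / x2 > y2 / y1" "x1 / x2 > y1 / y2"
    and Y: "Y = gi_class (Interval (- y1, y2)) 0"
  define D where "D = x1\<^sup>2 - x2\<^sup>2"
  define z1 where "z1 = (x1 * y2 - x2 * y1) / D"
  define z2 where "z2 = (x1 * y1 - x2 * y2) / D"
  have "D > 0"
    unfolding D_def using assms(2,3) by (simp add: power_strict_mono)
  have "x1 * y2 - x2 * y1 > 0" "x1 * y1 - x2 * y2 > 0"
    using ratios y assms(2) by (simp_all add: field_simps)
  then have z: "z1 > 0" "z2 > 0"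
    unfolding z1_def z2_def using \<open>D > 0\<close> by simp_all
  have "x1 * z2 + x2 * z1 = y1 * D / D" "x1 * z1 + x2 * z2 = y2 * D / D"
    unfolding z1_def z2_def times_divide_eq_right add_divide_distrib[symmetric]
    by (simp_all add: D_def power2_eq_square algebra_simps)
  then have "x1 * z2 + x2 * z1 = y1" "x1 * z1 + x2 * z2 = y2"
    using \<open>D > 0\<close> by simp_all
  then have "Y = X \<bullet>\<^sub>I gi_class (Interval (- z1, z2)) 0"
    using gi_mult_straddling_zero[of x1 x2 z1 z2] assms(1,2) z by (simp add: Y assms(4))
  moreover have "- z1 \<le> z2"
    using z by simp
  ultimately show "\<exists>(z1 :: real) (z2 :: real) Z.
      - z1 \<le> z2 \<and> Z = gi_class (Interval (- z1, z2)) 0 \<and> Y = X \<bullet>\<^sub>I Z"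
    by blast
qed

end
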